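(* Let $V_1, V_2$ be two spherical systems of generators of a finite group $G$. Assume that the associated topological types of $G$-coverings of $\mathbb P^1$ are different. Then the set of families of product-quotient surfaces associated to this pair of topological types of $G$-coverings is in natural bijection with the set of double cosets $$\mathcal B\mathrm{Aut}(G, V_1)\backslash \mathrm{Aut}(G)/ \mathcal B\mathrm{Aut}(G, V_2).$$
   Context: A spherical system of generators (of length $r$) of a finite group $G$ is a sequence $V=[g_1,\dots,g_r]\in G^r$ with $g_i\neq 1$ for all $i$, $G=\langle g_1,\dots,g_r\rangle$ and $g_1\cdots g_r=1$; $\mathcal D^r(G)$ is the set of all of them. The braid group $\mathcal B_r=\langle\sigma_1,\dots,\sigma_{r-1}\mid \sigma_i\sigma_j=\sigma_j\sigma_i\ (|i-j|>1),\ \sigma_i\sigma_j\sigma_i=\sigma_j\sigma_i\sigma_j\ (|i-j|=1)\rangle$ acts on $\mathcal D^r(G)$ by $\sigma_i\cdot[g_1,\dots,g_r]=[g_1,\dots,g_{i-1},g_ig_{i+1}g_i^{-1},g_i,g_{i+2},\dots,g_r]$, and $\mathrm{Aut}(G)$ acts by $\Psi\cdot[g_1,\dots,g_r]=[\Psi(g_1),\dots,\Psi(g_r)]$; these actions commute. A $G$-covering of $\mathbb P^1$ is a compact Riemann surface $C$ with a (faithful) holomorphic action of $G$ such that $C/G\cong\mathbb P^1$. Two $G$-coverings $C_1,C_2$ are topologically equivalent (have the same topological type) if there are an orientation preserving homeomorphism $f\colon C_1\to C_2$ and $\varphi\in\mathrm{Aut}(G)$ with $f(g\cdot p)=\varphi(g)\cdot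 f(p)$ for all $g\in G$, $p\in C_1$. By Riemann's existence theorem, $V=[g_1,\dots,g_r]\in\mathcal D^r(G)$ determines a $G$-covering branched over $r$ points with local monodromies $g_1,\dots,g_r$; topological types of $G$-coverings branched over $r$ points correspond bijectively to the orbits in $\mathcal D^r(G)/(\mathrm{Aut}(G)\times\mathcal B_r)$. A product-quotient surface is the minimal resolution of singularities of $(C_1\times C_2)/G$, where $G$ acts faithfully on smooth projective curves $C_1,C_2$ of genus at least $2$ and diagonally on $C_1\times C_2$. A pair $(V_1,V_2)\in\mathcal D^r(G)\times\mathcal D^s(G)$ defines, via the corresponding $G$-coverings $C_1,C_2$, a regular product-quotient surface, up to moving the branch points. Families of regular product-quotient surfaces whose $G$-coverings $C_1, C_2$ (in this order) are branched over $r$ and $s$ points are identified with the elements of $(\mathcal D^r(G)\times\mathcal D^s(G))/(\mathrm{Aut}(G)\times\mathcal B_r\times\mathcal B_s)$, where $\mathrm{Aut}(G)$ acts simultaneously on both factors and $\mathcal B_r$, $\mathcal B_s$ act on the first and second factor respectively. The families associated to the pair of topological types given by $V_1$ and $V_2$ are those corresponding to orbits of pairs $(V_1',V_2')$ with $V_1'$ in the $\mathrm{Aut}(G)\times\mathcal B_r$-orbit of $V_1$ and $V_2'$ in the $\mathrm{Aut}(G)\times\mathcal B_s$-orbit of $V_2$. (Exchanging the two factors gives isomorphic families, so for two different topological types it suffices to fix their order.) For $V\in\mathcal D^r(G)$, $\mathcal B\mathrm{Aut}(G,V):=\{\varphi\in\mathrm{Aut}(G) : \exists\,\sigma\in\mathcal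 B_r \text{ such that } \varphi\cdot V=\sigma\cdot V\}$, which is a subgroup of $\mathrm{Aut}(G)$. *)

theory Defs
  imports "HOL-Algebra.Generated_Groups" "HOL-Algebra.Group_Action"
begin

section \<open>Spherical systems of generators\<close>

definition spherical_systems :: "('a, 'b) monoid_scheme \<Rightarrow> nat \<Rightarrow> 'a list set" where
  "spherical_systems G r =
     {V. length V = r \<and> set V \<subseteq> carrier G \<and> \<one>\<^bsub>G\<^esub> \<notin> set V \<and>
         generate G (set V) = carrier G \<and> foldr (\<otimes>\<^bsub>G\<^esub>) V \<one>\<^bsub>G\<^esub> = \<one>\<^bsub>G\<^esub>}"


section \<open>The braid group, by generators and relations\<close>

text \<open>A word is a list of letters \<open>(i, b)\<close> with \<open>1 \<le> i < r\<close>: \<open>(i, True)\<close> stands for the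
  generator \<open>\<sigma>\<^sub>i\<close> and \<open>(i, False)\<close> for its formal inverse.\<close>

type_synonym braid_word = "(nat \<times> bool) list"

definition braid_words :: "nat \<Rightarrow> braid_word set" where
  "braid_words r = lists ({1..<r} \<times> UNIV)"

inductive braid_equiv :: "nat \<Rightarrow> braid_word \<Rightarrow> braid_word \<Rightarrow> bool" for r where
  word_refl: "u \<in> braid_words r \<Longrightarrow> braid_equiv r u u"
| word_sym: "braid_equiv r u v \<Longrightarrow> braid_equiv r v u"
| word_trans: "braid_equiv r u v \<Longrightarrow> braid_equiv r v w \<Longrightarrow> braid_equiv r u w"
| word_append: "braid_equiv r u u' \<Longrightarrow> braid_equiv r v v' \<Longrightarrow> braid_equiv r (u @ v) (u' @ v')"
| word_cancel: "i \<in> {1..<r} \<Longrightarrow> braid_equiv r [(i, b), (i, \<not> b)] []"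
| far_commute: "i \<in> {1..<r} \<Longrightarrow> j \<in> {1..<r} \<Longrightarrow> \<bar>int i - int j\<bar> > 1 \<Longrightarrow>
    braid_equiv r [(i, True), (j, True)] [(j, True), (i, True)]"
| braid_relation: "i \<in> {1..<r} \<Longrightarrow> j \<in> {1..<r} \<Longrightarrow> \<bar>int i - int j\<bar> = 1 \<Longrightarrow>
    braid_equiv r [(i, True), (j, True), (i, True)] [(j, True), (i, True), (j, True)]"

definition braid_class :: "nat \<Rightarrow> braid_word \<Rightarrow> braid_word set" where
  "braid_class r u = {v. braid_equiv r u v}"

definition braid_group :: "nat \<Rightarrow> braid_word set monoid" where
  "braid_group r =
     \<lparr>carrier = braid_class r ` braid_words r,
      mult = (\<lambda>A B. \<Union>u\<in>A. \<Union>v\<in>B. braid_class r (u @ v)),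
      one = braid_class r []\<rparr>"

lemma braid_equiv_words:
  "braid_equiv r u v \<Longrightarrow> u \<in> braid_words r \<and> v \<in> braid_words r"
  by (induction rule: braid_equiv.induct) (auto simp: braid_words_def)

lemma braid_class_eq_iff:
  assumes "u \<in> braid_words r"
  shows "braid_class r u = braid_class r v \<longleftrightarrow> braid_equiv r u v"
proof
  assume "braid_class r u = braid_class r v"
  moreover have "u \<in> braid_class r u"
    using assms by (simp add: braid_class_def word_refl)
  ultimately show "braid_equiv r u v"
    by (simp add: braid_class_def word_sym)
next
  assume "braid_equiv r u v"
  then show "braid_class r u = braid_class r v"
    unfolding braid_class_def by (blast intro: word_sym word_trans)
qed

lemma braid_class_self: "u \<in> braid_words r \<Longrightarrow> u \<in> braid_class r u"
  by (simp add: braid_class_def word_refl)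

lemma braid_group_mult:
  assumes "u \<in> braid_words r" "v \<in> braid_words r"
  shows "braid_class r u \<otimes>\<^bsub>braid_group r\<^esub> braid_class r v = braid_class r (u @ v)"
proof -
  have "braid_class r (u' @ v') = braid_class r (u @ v)"
    if "u' \<in> braid_class r u" "v' \<in> braid_class r v" for u' v'
  proof -
    have "braid_equiv r (u @ v) (u' @ v')"
      using that by (simp add: braid_class_def word_append)
    moreover from this have "u @ v \<in> braid_words r"
      by (simp add: braid_equiv_words)
    ultimately show ?thesis
      by (intro sym[OF iffD2[OF braid_class_eq_iff]])
  qed
  moreover have "u \<in> braid_class r u" "v \<in> braid_class r v"
    using assms by (simp_all add: braid_class_self)
  ultimately have "(\<Union>u'\<in>braid_class r u. \<Union>v'\<in>braid_class r v. braid_class r (u' @ v')) =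
      braid_class r (u @ v)"
    by blast
  then show ?thesis
    by (simp add: braid_group_def)
qed

lemma braid_word_inverse:
  "u \<in> braid_words r \<Longrightarrow>
    rev (map (apsnd Not) u) \<in> braid_words r \<and> braid_equiv r (rev (map (apsnd Not) u) @ u) []"
proof (induction u)
  case Nil
  then show ?case by (simp add: braid_words_def word_refl)
next
  case (Cons x u)
  obtain i b where x: "x = (i, b)" by force
  let ?u' = "rev (map (apsnd Not) u)"
  have u: "u \<in> braid_words r" and i: "i \<in> {1..<r}"
    using Cons.prems x by (auto simp: braid_words_def)
  have u': "?u' \<in> braid_words r" and IH: "braid_equiv r (?u' @ u) []"
    using Cons.IH[OF u] by auto
  have "braid_equiv r [(i, \<not> b), (i, b)] []"
    using word_cancel[OF i, of "\<not> b"] by simp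
  then have "braid_equiv r (?u' @ ([(i, \<not> b), (i, b)] @ u)) (?u' @ ([] @ u))"
    using u u' by (intro word_append word_refl)
  then have "braid_equiv r (rev (map (apsnd Not) (x # u)) @ x # u) (?u' @ u)"
    by (simp add: x)
  then have "braid_equiv r (rev (map (apsnd Not) (x # u)) @ x # u) []"
    using IH by (rule word_trans)
  moreover have "rev (map (apsnd Not) (x # u)) \<in> braid_words r"
    using u' i by (simp add: braid_words_def x)
  ultimately show ?case by blast
qed

lemma group_braid_group: "group (braid_group r)"
proof (rule groupI)
  have words_append: "u @ v \<in> braid_words r" if "u \<in> braid_words r" "v \<in> braid_words r" for u v
    using that by (simp add: braid_words_def)
  have carrier: "carrier (braid_group r) = braid_class r ` braid_words r"
    and one: "\<one>\<^bsub>braid_group r\<^esub> = braid_class r []"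
    and Nil: "[] \<in> braid_words r"
    by (simp_all add: braid_group_def braid_words_def)
  show "\<one>\<^bsub>braid_group r\<^esub> \<in> carrier (braid_group r)"
    unfolding carrier one using Nil by (rule imageI)
  fix x assume "x \<in> carrier (braid_group r)"
  then obtain u where u: "u \<in> braid_words r" "x = braid_class r u"
    unfolding carrier by blast
  show "\<one>\<^bsub>braid_group r\<^esub> \<otimes>\<^bsub>braid_group r\<^esub> x = x"
    using u Nil by (simp add: one braid_group_mult)
  show "\<exists>y\<in>carrier (braid_group r). y \<otimes>\<^bsub>braid_group r\<^esub> x = \<one>\<^bsub>braid_group r\<^esub>"
  proof (rule bexI)
    let ?u' = "rev (map (apsnd Not) u)"
    have u': "?u' \<in> braid_words r" "braid_equiv r (?u' @ u) []"
      using braid_word_inverse[OF u(1)] by blast+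
    show "braid_class r ?u' \<in> carrier (braid_group r)"
      unfolding carrier using u'(1) by (rule imageI)
    have "braid_class r (?u' @ u) = braid_class r []"
      using braid_class_eq_iff[OF words_append[OF u'(1) u(1)]] u'(2) by blast
    then show "braid_class r ?u' \<otimes>\<^bsub>braid_group r\<^esub> x = \<one>\<^bsub>braid_group r\<^esub>"
      unfolding u(2) one by (simp only: braid_group_mult[OF u'(1) u(1)])
  qed
  fix y assume "y \<in> carrier (braid_group r)"
  then obtain v where v: "v \<in> braid_words r" "y = braid_class r v"
    unfolding carrier by blast
  show "x \<otimes>\<^bsub>braid_group r\<^esub> y \<in> carrier (braid_group r)"
    using u v by (simp add: carrier braid_group_mult words_append)
  fix z assume "z \<in> carrier (braid_group r)"
  then obtain w where w: "w \<in> braid_words r" "z = braid_class r w"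
    unfolding carrier by blast
  show "x \<otimes>\<^bsub>braid_group r\<^esub> y \<otimes>\<^bsub>braid_group r\<^esub> z =
        x \<otimes>\<^bsub>braid_group r\<^esub> (y \<otimes>\<^bsub>braid_group r\<^esub> z)"
    using u v w by (simp add: braid_group_mult words_append)
qed


section \<open>The actions on spherical systems\<close>

text \<open>Lists are indexed from 0, so the entries \<open>g\<^sub>i\<close> and \<open>g\<^sub>i\<^sub>+\<^sub>1\<close> of \<open>V\<close> are
  \<open>V ! (i - 1)\<close> and \<open>V ! i\<close>. The second clause is the inverse of the first.\<close>

fun braid_letter_act :: "('a, 'b) monoid_scheme \<Rightarrow> nat \<times> bool \<Rightarrow> 'a list \<Rightarrow> 'a list" where
  "braid_letter_act G (i, True) V =
     V[i - 1 := V ! (i - 1) \<otimes>\<^bsub>G\<^esub> V ! i \<otimes>\<^bsub>G\<^esub> inv\<^bsub>G\<^esub> (V ! (i - 1)), i := V ! (i - 1)]"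
| "braid_letter_act G (i, False) V =
     V[i - 1 := V ! i, i := inv\<^bsub>G\<^esub> (V ! i) \<otimes>\<^bsub>G\<^esub> V ! (i - 1) \<otimes>\<^bsub>G\<^esub> V ! i]"

declare braid_letter_act.simps [simp del]

definition braid_word_act :: "('a, 'b) monoid_scheme \<Rightarrow> braid_word \<Rightarrow> 'a list \<Rightarrow> 'a list" where
  "braid_word_act G w V = foldr (braid_letter_act G) w V"

text \<open>All words in a class act in the same way (lemma \<open>braid_action_class\<close> below), so the image
  below is a singleton.\<close>

definition braid_action ::
    "('a, 'b) monoid_scheme \<Rightarrow> nat \<Rightarrow> braid_word set \<Rightarrow> 'a list \<Rightarrow> 'a list" where
  "braid_action G r \<sigma> =
     (\<lambda>V\<in>spherical_systems G r. the_elem ((\<lambda>w. braid_word_act G w V) ` \<sigma>))"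

definition aut_action ::
    "('a, 'b) monoid_scheme \<Rightarrow> nat \<Rightarrow> ('a \<Rightarrow> 'a) \<Rightarrow> 'a list \<Rightarrow> 'a list" where
  "aut_action G r \<phi> = (\<lambda>V\<in>spherical_systems G r. map \<phi> V)"

definition type_action ::
    "('a, 'b) monoid_scheme \<Rightarrow> nat \<Rightarrow> ('a \<Rightarrow> 'a) \<times> braid_word set \<Rightarrow> 'a list \<Rightarrow> 'a list" where
  "type_action G r = (\<lambda>(\<phi>, \<sigma>). \<lambda>V\<in>spherical_systems G r. aut_action G r \<phi> (braid_action G r \<sigma> V))"

definition pair_action ::
    "('a, 'b) monoid_scheme \<Rightarrow> nat \<Rightarrow> nat \<Rightarrow>
     ('a \<Rightarrow> 'a) \<times> braid_word set \<times> braid_word set \<Rightarrow> 'a list \<times> 'a list \<Rightarrow> 'a list \<times> 'a list" where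
  "pair_action G r s = (\<lambda>(\<phi>, \<sigma>, \<tau>). \<lambda>(V, W)\<in>spherical_systems G r \<times> spherical_systems G s.
     (aut_action G r \<phi> (braid_action G r \<sigma> V), aut_action G s \<phi> (braid_action G s \<tau> W)))"


section \<open>Topological types, families and double cosets\<close>

text \<open>By Riemann's existence theorem, topological types of \<open>G\<close>-coverings of the projective line
  branched over \<open>r\<close> points are identified with orbits of \<open>Aut(G) \<times> B\<^sub>r\<close>, and families of regular
  product-quotient surfaces whose two coverings are branched over \<open>r\<close> and \<open>s\<close> points are
  identified with orbits of \<open>Aut(G) \<times> B\<^sub>r \<times> B\<^sub>s\<close>, where \<open>Aut(G)\<close> acts simultaneously on both
  factors.\<close>

definition topological_type :: "('a, 'b) monoid_scheme \<Rightarrow> nat \<Rightarrow> 'a list \<Rightarrow> 'a list set" where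
  "topological_type G r V = orbit (AutoGroup G \<times>\<times> braid_group r) (type_action G r) V"

definition pq_family ::
    "('a, 'b) monoid_scheme \<Rightarrow> nat \<Rightarrow> nat \<Rightarrow> 'a list \<times> 'a list \<Rightarrow> ('a list \<times> 'a list) set" where
  "pq_family G r s VW =
     orbit (AutoGroup G \<times>\<times> braid_group r \<times>\<times> braid_group s) (pair_action G r s) VW"

definition families_of_types ::
    "('a, 'b) monoid_scheme \<Rightarrow> nat \<Rightarrow> nat \<Rightarrow> 'a list set \<Rightarrow> 'a list set \<Rightarrow>
     ('a list \<times> 'a list) set set" where
  "families_of_types G r s T1 T2 = {pq_family G r s (V, W) | V W. V \<in> T1 \<and> W \<in> T2}"

definition BAut :: "('a, 'b) monoid_scheme \<Rightarrow> nat \<Rightarrow> 'a list \<Rightarrow> ('a \<Rightarrow> 'a) set" where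
  "BAut G r V = {\<phi> \<in> carrier (AutoGroup G).
     \<exists>\<sigma>\<in>carrier (braid_group r). aut_action G r \<phi> V = braid_action G r \<sigma> V}"

definition double_coset :: "('c, 'd) monoid_scheme \<Rightarrow> 'c set \<Rightarrow> 'c \<Rightarrow> 'c set \<Rightarrow> 'c set" where
  "double_coset M H a K = H #>\<^bsub>M\<^esub> a <#>\<^bsub>M\<^esub> K"

definition double_cosets :: "('c, 'd) monoid_scheme \<Rightarrow> 'c set \<Rightarrow> 'c set \<Rightarrow> 'c set set" where
  "double_cosets M H K = (\<lambda>a. double_coset M H a K) ` carrier M"


section \<open>Well-definedness of the actions\<close>

context group
begin

lemma inv_cancel_left:
  assumes "x \<in> carrier G" "y \<in> carrier G"
  shows "x \<otimes> (inv x \<otimes> y) = y" "inv x \<otimes> (x \<otimes> y) = y"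
  using assms by (simp_all add: m_assoc[symmetric])

lemma conj_ne_one:
  assumes "x \<in> carrier G" "y \<in> carrier G" "y \<noteq> \<one>"
  shows "x \<otimes> y \<otimes> inv x \<noteq> \<one>" "inv x \<otimes> y \<otimes> x \<noteq> \<one>"
proof
  assume "x \<otimes> y \<otimes> inv x = \<one>"
  then have "inv x \<otimes> (x \<otimes> y \<otimes> inv x) \<otimes> x = \<one>" using assms by simp
  then show False using assms by (simp add: m_assoc inv_cancel_left)
next
  show "inv x \<otimes> y \<otimes> x \<noteq> \<one>"
  proof
    assume "inv x \<otimes> y \<otimes> x = \<one>"
    then have "x \<otimes> (inv x \<otimes> y \<otimes> x) \<otimes> inv x = \<one>" using assms by simp
    then show False using assms by (simp add: m_assoc inv_cancel_left)
  qed
qed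

lemma list_update_middle:
  assumes "1 \<le> i" "i < length V"
  shows "\<exists>A a b B. V = A @ [a, b] @ B \<and> length A = i - 1"
proof -
  have "drop (i - 1) V = V ! (i - 1) # drop i V"
    using assms Cons_nth_drop_Suc[of "i - 1" V] by simp
  moreover have "drop i V = V ! i # drop (Suc i) V"
    using assms Cons_nth_drop_Suc[of i V] by simp
  ultimately have "V = take (i - 1) V @ [V ! (i - 1), V ! i] @ drop (Suc i) V"
    using append_take_drop_id[of "i - 1" V] by simp
  moreover have "length (take (i - 1) V) = i - 1" using assms by simp
  ultimately show ?thesis by blast
qed

lemma letter_act_split:
  assumes "length A = i - 1" "1 \<le> i"
  shows "braid_letter_act G (i, True) (A @ a # b # B) = A @ (a \<otimes> b \<otimes> inv a) # a # B"
    and "braid_letter_act G (i, False) (A @ a # b # B) = A @ b # (inv b \<otimes> a \<otimes> b) # B"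
proof -
  obtain k where k: "i = Suc k" using assms by (cases i) auto
  then have "k = length A" using assms by simp
  then show "braid_letter_act G (i, True) (A @ a # b # B) = A @ (a \<otimes> b \<otimes> inv a) # a # B"
    and "braid_letter_act G (i, False) (A @ a # b # B) = A @ b # (inv b \<otimes> a \<otimes> b) # B"
    by (simp_all add: k braid_letter_act.simps list_update_append nth_append)
qed

lemma letter_act_spherical:
  assumes i: "i \<in> {1..<r}" and V: "V \<in> spherical_systems G r"
  shows "braid_letter_act G (i, c) V \<in> spherical_systems G r"
    and "braid_letter_act G (i, c) (braid_letter_act G (i, \<not> c) V) = V"
proof -
  have len: "length V = r" and VG: "set V \<subseteq> carrier G" and V1: "\<one> \<notin> set V"
    and gen: "generate G (set V) = carrier G" and prod: "foldr (\<otimes>) V \<one> = \<one>"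
    using V by (auto simp: spherical_systems_def)
  obtain A a b B where split: "V = A @ [a, b] @ B" and lA: "length A = i - 1"
    using list_update_middle[of i V] i len by auto
  have i1: "1 \<le> i" using i by simp
  have a: "a \<in> carrier G" and b: "b \<in> carrier G" and B: "set B \<subseteq> carrier G"
    and A: "set A \<subseteq> carrier G" using VG split by auto
  have prodB: "foldr (\<otimes>) B \<one> \<in> carrier G"
    using B by (induction B) auto
  note acts = letter_act_split[OF lA i1]
  show "braid_letter_act G (i, c) (braid_letter_act G (i, \<not> c) V) = V"
    using a b by (cases c) (simp_all add: split acts m_assoc inv_cancel_left inv_mult_group)
  define a' where "a' = (if c then a \<otimes> b \<otimes> inv a else b)"
  define b' where "b' = (if c then a else inv b \<otimes> a \<otimes> b)"
  have W: "braid_letter_act G (i, c) V = A @ a' # b' # B"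
    by (cases c) (simp_all add: split acts a'_def b'_def)
  have a': "a' \<in> carrier G" and b': "b' \<in> carrier G"
    using a b by (auto simp: a'_def b'_def)
  have ab: "a' \<otimes> b' = a \<otimes> b"
    using a b by (auto simp: a'_def b'_def m_assoc inv_mult_group inv_cancel_left)
  have ne: "a' \<noteq> \<one>" "b' \<noteq> \<one>"
  proof -
    have "a \<noteq> \<one>" "b \<noteq> \<one>" using V1 split by auto
    then show "a' \<noteq> \<one>" "b' \<noteq> \<one>" using a b
      by (simp_all add: a'_def b'_def conj_ne_one)
  qed
  have "foldr (\<otimes>) (A @ a' # b' # B) \<one> = foldr (\<otimes>) V \<one>"
    using a b a' b' prodB ab by (simp add: split m_assoc[symmetric])
  moreover have "generate G (set (A @ a' # b' # B)) = carrier G"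
  proof -
    let ?S = "set (A @ a' # b' # B)"
    have S: "?S \<subseteq> carrier G" using A B a' b' by auto
    have sub: "subgroup (generate G ?S) G" by (rule generate_is_subgroup[OF S])
    have in': "a' \<in> generate G ?S" "b' \<in> generate G ?S" by (auto intro: generate.incl)
    have "a = (if c then b' else a' \<otimes> b' \<otimes> inv a')"
         "b = (if c then inv b' \<otimes> a' \<otimes> b' else a')"
      using a b by (auto simp: a'_def b'_def m_assoc inv_mult_group inv_cancel_left)
    then have "a \<in> generate G ?S" "b \<in> generate G ?S"
      using in' subgroup.m_closed[OF sub] subgroup.m_inv_closed[OF sub] by auto
    then have "set V \<subseteq> generate G ?S"
      unfolding split by (auto intro: generate.incl)
    then have "generate G (set V) \<subseteq> generate G ?S"
      by (rule generate_subgroup_incl[OF _ sub])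
    then show ?thesis using gen generate_incl[OF S] by auto
  qed
  ultimately show "braid_letter_act G (i, c) V \<in> spherical_systems G r"
    unfolding W spherical_systems_def
    using len prod V1 ne A B a' b' by (auto simp: split)
qed

lemma word_act_spherical:
  assumes "w \<in> braid_words r" "V \<in> spherical_systems G r"
  shows "braid_word_act G w V \<in> spherical_systems G r"
  using assms
  by (induction w) (auto simp: braid_word_act_def braid_words_def letter_act_spherical(1))

lemma word_act_append:
  "braid_word_act G (u @ v) V = braid_word_act G u (braid_word_act G v V)"
  by (simp add: braid_word_act_def)

lemma letter_act_braid_relation:
  assumes i: "1 \<le> i" "Suc i < length V" and VG: "set V \<subseteq> carrier G"
  shows "braid_word_act G [(i, True), (Suc i, True), (i, True)] V =
         braid_word_act G [(Suc i, True), (i, True), (Suc i, True)] V"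
proof -
  obtain A a b B' where V: "V = A @ [a, b] @ B'" and lA: "length A = i - 1"
    using list_update_middle[of i V] i by auto
  obtain c B where B': "B' = c # B"
    using V lA i by (cases B') auto
  have carr: "a \<in> carrier G" "b \<in> carrier G" "c \<in> carrier G"
    using VG V B' by auto
  have lA': "length (A @ [x]) = Suc i - 1" for x using lA i by simp
  have 1: "braid_letter_act G (i, True) (A @ x # y # z # B) = A @ (x \<otimes> y \<otimes> inv x) # x # z # B" 
    for x y z using letter_act_split(1)[OF lA i(1)] .
  have 2: "braid_letter_act G (Suc i, True) (A @ x # y # z # B) = A @ x # (y \<otimes> z \<otimes> inv y) # y # B" 
    for x y z using letter_act_split(1)[OF lA', of x y z B] by simp
  show ?thesis
    using carr by (simp add: V B' braid_word_act_def 1 2 m_assoc inv_mult_group inv_cancel_left)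
qed

lemma letter_act_commute_relation:
  assumes i: "1 \<le> i" "Suc i < j" "j < length V" 
  shows "braid_word_act G [(i, True), (j, True)] V = braid_word_act G [(j, True), (i, True)] V"
proof -
  obtain A a b B' where V: "V = A @ [a, b] @ B'" and lA: "length A = i - 1"
    using list_update_middle[of i V] i by auto
  have lV: "length V = Suc i + length B'" using V lA i by simp
  have "1 \<le> j - Suc i" "j - Suc i < length B'" using i lV by linarith+
  then obtain B c d C where B': "B' = B @ [c, d] @ C" and lB: "length B = (j - Suc i) - 1"
    using list_update_middle[of "j - Suc i" B'] by blast
  have lAB: "length (A @ x # y # B) = j - 1" for x y using lA lB i by simp
  have 1: "braid_letter_act G (i, True) (A @ x # y # D) = A @ (x \<otimes> y \<otimes> inv x) # x # D" 
    for x y D using letter_act_split(1)[OF lA i(1)] .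
  have 2: "braid_letter_act G (j, True) (A @ x # y # B @ z # t # C) =
      A @ x # y # B @ (z \<otimes> t \<otimes> inv z) # z # C" for x y z t
    using letter_act_split(1)[OF lAB, of x y z t C] i by simp
  show ?thesis by (simp add: V B' braid_word_act_def 1 2)
qed

lemma word_act_equiv:
  assumes "braid_equiv r u v" "V \<in> spherical_systems G r"
  shows "braid_word_act G u V = braid_word_act G v V"
  using assms
proof (induction arbitrary: V rule: braid_equiv.induct)
  case (word_refl u)
  then show ?case by simp
next
  case (word_sym u v)
  then show ?case by metis
next
  case (word_trans u v w)
  then show ?case by metis
next
  case (word_append u u' v v')
  have "v \<in> braid_words r"
    using word_append.hyps braid_equiv_words by blast
  then have "braid_word_act G v V \<in> spherical_systems G r"
    using word_append.prems word_act_spherical by blast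
  then show ?case
    using word_append.IH word_append.prems by (simp add: word_act_append)
next
  case (word_cancel i b)
  then show ?case
    using letter_act_spherical(2)[of i r V b] by (simp add: braid_word_act_def)
next
  case (far_commute i j)
  have len: "length V = r" using far_commute.prems by (simp add: spherical_systems_def)
  have "Suc i < j \<or> Suc j < i" using far_commute.hyps by linarith
  then show ?case
  proof
    assume "Suc i < j"
    then show ?thesis
      by (intro letter_act_commute_relation) (use far_commute.hyps len in auto)
  next
    assume "Suc j < i"
    then show ?thesis
      by (intro letter_act_commute_relation[symmetric]) (use far_commute.hyps len in auto)
  qed
next
  case (braid_relation i j)
  have len: "length V = r" "set V \<subseteq> carrier G"
    using braid_relation.prems by (auto simp: spherical_systems_def)
  have "j = Suc i \<or> i = Suc j" using braid_relation.hyps by linarith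
  then show ?case
  proof
    assume j: "j = Suc i"
    show ?thesis
      unfolding j by (rule letter_act_braid_relation) (use braid_relation.hyps j len in auto)
  next
    assume i: "i = Suc j"
    show ?thesis
      unfolding i by (rule letter_act_braid_relation[symmetric]) (use braid_relation.hyps i len in auto)
  qed
qed

lemma braid_action_class:
  assumes "w \<in> braid_words r" "V \<in> spherical_systems G r"
  shows "braid_action G r (braid_class r w) V = braid_word_act G w V"
proof -
  have "(\<lambda>w. braid_word_act G w V) ` braid_class r w = {braid_word_act G w V}"
  proof -
    have "braid_word_act G w' V = braid_word_act G w V" if "w' \<in> braid_class r w" for w'
      using word_act_equiv[OF word_sym _, of r w w' V] that assms(2)
      by (simp add: braid_class_def)
    then show ?thesis
      using braid_class_self[OF assms(1)] by blast
  qed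
  then show ?thesis using assms(2) by (simp add: braid_action_def)
qed

lemma aut_action_spherical:
  assumes \<phi>: "\<phi> \<in> carrier (AutoGroup G)" and V: "V \<in> spherical_systems G r"
  shows "aut_action G r \<phi> V \<in> spherical_systems G r"
proof -
  have hom: "\<phi> \<in> hom G G" and bij: "bij_betw \<phi> (carrier G) (carrier G)"
    using \<phi> by (auto simp: AutoGroup_def auto_def Bij_def)
  interpret \<phi>: group_hom G G \<phi>
    using hom by (simp add: group_hom_def group_hom_axioms_def is_group)
  have VG: "set V \<subseteq> carrier G" and V1: "\<one> \<notin> set V"
    and gen: "generate G (set V) = carrier G" and prod: "foldr (\<otimes>) V \<one> = \<one>"
    using V by (auto simp: spherical_systems_def)
  have fold: "foldr (\<otimes>) (map \<phi> U) \<one> = \<phi> (foldr (\<otimes>) U \<one>) \<and> foldr (\<otimes>) U \<one> \<in> carrier G"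
    if "set U \<subseteq> carrier G" for U
    using that by (induction U) auto
  have "\<one> \<notin> \<phi> ` set V"
    using V1 VG bij \<phi>.hom_one by (metis bij_betw_def image_iff inj_on_eq_iff one_closed subsetD)
  moreover have "generate G (\<phi> ` set V) = carrier G"
    using \<phi>.generate_img[OF VG] gen bij by (simp add: bij_betw_def)
  moreover have "\<phi> ` set V \<subseteq> carrier G" using VG by auto
  ultimately show ?thesis
    using V fold[OF VG] prod by (simp add: aut_action_def spherical_systems_def)
qed

lemma letter_act_map:
  assumes \<phi>: "\<phi> \<in> carrier (AutoGroup G)" and i: "i \<in> {1..<r}" and V: "V \<in> spherical_systems G r"
  shows "map \<phi> (braid_letter_act G (i, c) V) = braid_letter_act G (i, c) (map \<phi> V)"
proof -
  interpret \<phi>: group_hom G G \<phi>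
    using \<phi> by (simp add: AutoGroup_def auto_def group_hom_def group_hom_axioms_def is_group)
  have len: "length V = r" and VG: "set V \<subseteq> carrier G"
    using V by (auto simp: spherical_systems_def)
  moreover have "i < length V" "i - 1 < length V" using i len by auto
  ultimately have "V ! i \<in> carrier G" "V ! (i - 1) \<in> carrier G"
    "map \<phi> V ! i = \<phi> (V ! i)" "map \<phi> V ! (i - 1) = \<phi> (V ! (i - 1))"
    by auto
  then show ?thesis
    by (cases c) (simp_all add: braid_letter_act.simps map_update)
qed

lemma aut_braid_commute:
  assumes \<phi>: "\<phi> \<in> carrier (AutoGroup G)" and \<sigma>: "\<sigma> \<in> carrier (braid_group r)"
    and V: "V \<in> spherical_systems G r"
  shows "aut_action G r \<phi> (braid_action G r \<sigma> V) = braid_action G r \<sigma> (aut_action G r \<phi> V)"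
proof -
  obtain w where w: "w \<in> braid_words r" "\<sigma> = braid_class r w"
    using \<sigma> by (auto simp: braid_group_def)
  have "map \<phi> (braid_word_act G w V) = braid_word_act G w (map \<phi> V)"
    using w(1)
  proof (induction w)
    case (Cons x w)
    then obtain i c where x: "x = (i, c)" "i \<in> {1..<r}" "w \<in> braid_words r"
      by (auto simp: braid_words_def)
    then show ?case
      using Cons.IH letter_act_map[OF \<phi> x(2) word_act_spherical[OF x(3) V]]
      by (simp add: braid_word_act_def)
  qed (simp add: braid_word_act_def)
  then show ?thesis
    using w V aut_action_spherical[OF \<phi> V] word_act_spherical[OF w(1) V]
    by (simp add: braid_action_class aut_action_def)
qed

end

lemma group_actionI:
  assumes G: "group G"
    and closed: "\<And>g x. g \<in> carrier G \<Longrightarrow> x \<in> E \<Longrightarrow> f g x \<in> E"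
    and ext: "\<And>g. g \<in> carrier G \<Longrightarrow> f g \<in> extensional E"
    and one: "\<And>x. x \<in> E \<Longrightarrow> f \<one>\<^bsub>G\<^esub> x = x"
    and mult: "\<And>g h x. g \<in> carrier G \<Longrightarrow> h \<in> carrier G \<Longrightarrow> x \<in> E \<Longrightarrow>
      f (g \<otimes>\<^bsub>G\<^esub> h) x = f g (f h x)"
  shows "group_action G E f"
proof -
  interpret group G by (rule G)
  have bij: "f g \<in> Bij E" if g: "g \<in> carrier G" for g
  proof -
    have "bij_betw (f g) E E"
    proof (rule bij_betwI[where g = "f (inv\<^bsub>G\<^esub> g)"])
      show "f g \<in> E \<rightarrow> E" "f (inv\<^bsub>G\<^esub> g) \<in> E \<rightarrow> E" using closed g by auto
      show "f (inv\<^bsub>G\<^esub> g) (f g x) = x" if "x \<in> E" for x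
        using mult[of "inv\<^bsub>G\<^esub> g" g x] one g that by simp
      show "f g (f (inv\<^bsub>G\<^esub> g) x) = x" if "x \<in> E" for x
        using mult[of g "inv\<^bsub>G\<^esub> g" x] one g that by simp
    qed
    then show ?thesis using ext[OF g] by (simp add: Bij_def)
  qed
  have "f \<in> hom G (BijGroup E)"
  proof (rule homI)
    fix g h assume g: "g \<in> carrier G" and h: "h \<in> carrier G"
    have "f (g \<otimes>\<^bsub>G\<^esub> h) = compose E (f g) (f h)"
      by (rule extensionalityI[of _ E]) (use g h ext mult in \<open>auto simp: compose_eq\<close>)
    then show "f (g \<otimes>\<^bsub>G\<^esub> h) = f g \<otimes>\<^bsub>BijGroup E\<^esub> f h"
      using bij g h by (simp add: BijGroup_def)
  qed (use bij in \<open>simp add: BijGroup_def\<close>)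
  then show ?thesis
    by (simp add: group_action_def group_hom_def group_hom_axioms_def group_BijGroup G)
qed

context group
begin

lemma braid_action_group_action:
  "group_action (braid_group r) (spherical_systems G r) (braid_action G r)"
proof (rule group_actionI[OF group_braid_group])
  have carrier: "carrier (braid_group r) = braid_class r ` braid_words r"
    and one: "\<one>\<^bsub>braid_group r\<^esub> = braid_class r []"
    and Nil: "[] \<in> braid_words r"
    by (simp_all add: braid_group_def braid_words_def)
  show "braid_action G r g \<in> extensional (spherical_systems G r)" for g
    by (simp add: braid_action_def)
  fix x assume x: "x \<in> spherical_systems G r"
  show "braid_action G r \<one>\<^bsub>braid_group r\<^esub> x = x"
    using x Nil by (simp add: one braid_action_class braid_word_act_def)
  fix g assume g: "g \<in> carrier (braid_group r)"
  show "braid_action G r g x \<in> spherical_systems G r"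
    using g x by (auto simp: carrier braid_action_class word_act_spherical)
  fix h assume h: "h \<in> carrier (braid_group r)"
  obtain u v where uv: "u \<in> braid_words r" "v \<in> braid_words r"
    "g = braid_class r u" "h = braid_class r v"
    using g h unfolding carrier by blast
  have "u @ v \<in> braid_words r" using uv by (simp add: braid_words_def)
  then have "braid_action G r (g \<otimes>\<^bsub>braid_group r\<^esub> h) x = braid_word_act G (u @ v) x"
    unfolding uv(3,4) braid_group_mult[OF uv(1,2)] using x by (rule braid_action_class)
  moreover have "braid_action G r g (braid_action G r h x) =
      braid_word_act G u (braid_word_act G v x)"
    unfolding uv(3,4) braid_action_class[OF uv(2) x]
    by (rule braid_action_class[OF uv(1) word_act_spherical[OF uv(2) x]])
  ultimately show "braid_action G r (g \<otimes>\<^bsub>braid_group r\<^esub> h) x =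
      braid_action G r g (braid_action G r h x)"
    by (simp only: word_act_append)
qed

lemma aut_action_group_action:
  "group_action (AutoGroup G) (spherical_systems G r) (aut_action G r)"
proof (rule group_actionI[OF AutoGroup])
  show "aut_action G r g \<in> extensional (spherical_systems G r)" for g
    by (simp add: aut_action_def)
  fix x assume x: "x \<in> spherical_systems G r"
  then have xG: "set x \<subseteq> carrier G" by (simp add: spherical_systems_def)
  show "aut_action G r \<one>\<^bsub>AutoGroup G\<^esub> x = x"
    using x xG by (auto simp: aut_action_def AutoGroup_def BijGroup_def intro!: map_idI)
  fix g assume g: "g \<in> carrier (AutoGroup G)"
  show "aut_action G r g x \<in> spherical_systems G r"
    by (rule aut_action_spherical[OF g x])
  fix h assume h: "h \<in> carrier (AutoGroup G)"
  have "g \<otimes>\<^bsub>AutoGroup G\<^esub> h = compose (carrier G) g h"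
    using g h by (simp add: AutoGroup_def BijGroup_def auto_def)
  then show "aut_action G r (g \<otimes>\<^bsub>AutoGroup G\<^esub> h) x = aut_action G r g (aut_action G r h x)"
    using x xG aut_action_spherical[OF h x] by (auto simp: aut_action_def compose_eq)
qed

lemma type_action_group_action:
  "group_action (AutoGroup G \<times>\<times> braid_group r) (spherical_systems G r) (type_action G r)"
proof (rule group_actionI[OF DirProd_group[OF AutoGroup group_braid_group]])
  interpret A: group_action "AutoGroup G" "spherical_systems G r" "aut_action G r"
    by (rule aut_action_group_action)
  interpret B: group_action "braid_group r" "spherical_systems G r" "braid_action G r"
    by (rule braid_action_group_action)
  show "type_action G r g \<in> extensional (spherical_systems G r)" for g
    by (cases g) (simp add: type_action_def)
  fix x assume x: "x \<in> spherical_systems G r"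
  show "type_action G r \<one>\<^bsub>AutoGroup G \<times>\<times> braid_group r\<^esub> x = x"
    using x fun_cong[OF A.id_eq_one, of x] fun_cong[OF B.id_eq_one, of x]
    by (simp add: type_action_def)
  have A: "aut_action G r \<phi> V \<in> spherical_systems G r"
    if "\<phi> \<in> carrier (AutoGroup G)" "V \<in> spherical_systems G r" for \<phi> V
    using A.element_image[OF that refl] .
  have B: "braid_action G r \<sigma> V \<in> spherical_systems G r"
    if "\<sigma> \<in> carrier (braid_group r)" "V \<in> spherical_systems G r" for \<sigma> V
    using B.element_image[OF that refl] .
  fix g assume "g \<in> carrier (AutoGroup G \<times>\<times> braid_group r)"
  then obtain \<phi> \<sigma> where g: "g = (\<phi>, \<sigma>)" "\<phi> \<in> carrier (AutoGroup G)" "\<sigma> \<in> carrier (braid_group r)"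
    by auto
  show "type_action G r g x \<in> spherical_systems G r"
    using g x by (simp add: type_action_def A B)
  fix h assume "h \<in> carrier (AutoGroup G \<times>\<times> braid_group r)"
  then obtain \<psi> \<tau> where h: "h = (\<psi>, \<tau>)" "\<psi> \<in> carrier (AutoGroup G)" "\<tau> \<in> carrier (braid_group r)"
    by auto
  note \<tau>x = B[OF h(3) x]
  have "type_action G r (g \<otimes>\<^bsub>AutoGroup G \<times>\<times> braid_group r\<^esub> h) x =
      aut_action G r \<phi> (aut_action G r \<psi> (braid_action G r \<sigma> (braid_action G r \<tau> x)))"
    using x A.composition_rule[OF B[OF g(3) \<tau>x] g(2) h(2)] B.composition_rule[OF x g(3) h(3)]
    by (simp add: g(1) h(1) type_action_def)
  also have "\<dots> = aut_action G r \<phi> (braid_action G r \<sigma> (aut_action G r \<psi> (braid_action G r \<tau> x)))"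
    by (simp only: aut_braid_commute[OF h(2) g(3) \<tau>x])
  also have "\<dots> = type_action G r g (type_action G r h x)"
    using x A[OF h(2) \<tau>x] by (simp add: g(1) h(1) type_action_def)
  finally show "type_action G r (g \<otimes>\<^bsub>AutoGroup G \<times>\<times> braid_group r\<^esub> h) x =
      type_action G r g (type_action G r h x)" .
qed

lemma pair_action_group_action:
  "group_action (AutoGroup G \<times>\<times> braid_group r \<times>\<times> braid_group s)
     (spherical_systems G r \<times> spherical_systems G s) (pair_action G r s)"
proof (rule group_actionI[OF DirProd_group[OF AutoGroup DirProd_group]])
  show "group (braid_group r)" "group (braid_group s)" by (rule group_braid_group)+
  interpret R: group_action "AutoGroup G \<times>\<times> braid_group r" "spherical_systems G r" "type_action G r"
    by (rule type_action_group_action)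
  interpret S: group_action "AutoGroup G \<times>\<times> braid_group s" "spherical_systems G s" "type_action G s"
    by (rule type_action_group_action)
  have pair: "pair_action G r s (\<phi>, \<sigma>, \<tau>) (V, W) =
      (type_action G r (\<phi>, \<sigma>) V, type_action G s (\<phi>, \<tau>) W)"
    if "V \<in> spherical_systems G r" "W \<in> spherical_systems G s" for \<phi> \<sigma> \<tau> V W
    using that by (simp add: pair_action_def type_action_def)
  show "pair_action G r s g \<in> extensional (spherical_systems G r \<times> spherical_systems G s)" for g
    by (cases g) (simp add: pair_action_def)
  fix x assume x: "x \<in> spherical_systems G r \<times> spherical_systems G s"
  show "pair_action G r s \<one>\<^bsub>AutoGroup G \<times>\<times> braid_group r \<times>\<times> braid_group s\<^esub> x = x"
    using x fun_cong[OF R.id_eq_one, of "fst x"] fun_cong[OF S.id_eq_one, of "snd x"]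
    by (cases x) (simp add: pair)
  obtain V W where VW: "x = (V, W)" "V \<in> spherical_systems G r" "W \<in> spherical_systems G s"
    using x by auto
  fix g assume "g \<in> carrier (AutoGroup G \<times>\<times> braid_group r \<times>\<times> braid_group s)"
  then obtain \<phi> \<sigma> \<tau> where g: "g = (\<phi>, \<sigma>, \<tau>)" "(\<phi>, \<sigma>) \<in> carrier (AutoGroup G \<times>\<times> braid_group r)"
    "(\<phi>, \<tau>) \<in> carrier (AutoGroup G \<times>\<times> braid_group s)"
    by auto
  show "pair_action G r s g x \<in> spherical_systems G r \<times> spherical_systems G s"
    using R.element_image[OF g(2) VW(2) refl] S.element_image[OF g(3) VW(3) refl]
    by (simp add: VW g(1) pair)
  fix h assume "h \<in> carrier (AutoGroup G \<times>\<times> braid_group r \<times>\<times> braid_group s)"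
  then obtain \<phi>' \<sigma>' \<tau>' where h: "h = (\<phi>', \<sigma>', \<tau>')"
    "(\<phi>', \<sigma>') \<in> carrier (AutoGroup G \<times>\<times> braid_group r)"
    "(\<phi>', \<tau>') \<in> carrier (AutoGroup G \<times>\<times> braid_group s)"
    by auto
  show "pair_action G r s (g \<otimes>\<^bsub>AutoGroup G \<times>\<times> braid_group r \<times>\<times> braid_group s\<^esub> h) x =
      pair_action G r s g (pair_action G r s h x)"
    using R.element_image[OF h(2) VW(2) refl] S.element_image[OF h(3) VW(3) refl]
      R.composition_rule[OF VW(2) g(2) h(2)] S.composition_rule[OF VW(3) g(3) h(3)]
    by (simp add: VW g(1) h(1) pair)
qed

end

end

theory Submission
  imports Defs
begin

text \<open>
  Write \<open>A\<close> for the automorphism group of \<open>G\<close>. By simultaneous action of \<open>A\<close> and of the two braid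
  groups, every pair \<open>(V', W')\<close> of systems equivalent to \<open>V\<close> and \<open>W\<close> can be moved to one whose first
  component is \<open>V\<close> itself; what remains of \<open>W'\<close> after the second braid group is divided out is a
  translate \<open>\<phi> W\<close> with \<open>\<phi> \<in> A\<close> (lemma \<open>pq_family_representative\<close>). So the families are the
  orbits of the pairs \<open>(V, \<phi> W)\<close>, and the only question is when two such orbits agree.

  An element \<open>(\<alpha>, \<sigma>, \<tau>)\<close> taking \<open>(V, \<phi> W)\<close> to \<open>(V, \<psi> W)\<close> has \<open>\<alpha> \<sigma> V = V\<close> and
  \<open>\<psi>\<^sup>-\<^sup>1 \<alpha> \<phi> \<tau> W = W\<close>. The groups \<open>BAut\<close> are exactly the projections to \<open>A\<close> of the stabilizers under
  \<open>A\<close> times the braid group, so these equations say that \<open>\<alpha>\<close> lies in the group of \<open>V\<close> and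
  \<open>\<beta> = \<psi>\<^sup>-\<^sup>1 \<alpha> \<phi>\<close> in that of \<open>W\<close>, that is, \<open>\<psi> = \<alpha> \<phi> \<beta>\<^sup>-\<^sup>1\<close> is in the double coset of \<open>\<phi>\<close>
  (lemma \<open>pq_family_translate_eq_iff\<close>). The map from double cosets to families induced by
  \<open>\<phi> \<mapsto> (V, \<phi> W)\<close> is therefore well defined and bijective.
\<close>

section \<open>Double cosets\<close>

context group
begin

lemma mem_double_coset_iff:
  "b \<in> double_coset G H a K \<longleftrightarrow> (\<exists>h\<in>H. \<exists>k\<in>K. b = h \<otimes> a \<otimes> k)"
  by (auto simp: double_coset_def r_coset_def set_mult_def)

lemma double_coset_self:
  assumes "subgroup H G" "subgroup K G" "a \<in> carrier G"
  shows "a \<in> double_coset G H a K"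
proof -
  have "a = \<one> \<otimes> a \<otimes> \<one>" using assms(3) by simp
  then show ?thesis
    unfolding mem_double_coset_iff using assms(1,2) subgroup.one_closed by metis
qed

lemma double_coset_subset:
  assumes H: "subgroup H G" and K: "subgroup K G" and a: "a \<in> carrier G"
    and b: "b \<in> double_coset G H a K"
  shows "double_coset G H b K \<subseteq> double_coset G H a K"
proof
  obtain h k where hk: "h \<in> H" "k \<in> K" "b = h \<otimes> a \<otimes> k"
    using b by (auto simp: mem_double_coset_iff)
  fix c assume "c \<in> double_coset G H b K"
  then obtain h' k' where hk': "h' \<in> H" "k' \<in> K" "c = h' \<otimes> b \<otimes> k'"
    by (auto simp: mem_double_coset_iff)
  have carrier: "h \<in> carrier G" "h' \<in> carrier G" "k \<in> carrier G" "k' \<in> carrier G"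
    using hk hk' subgroup.mem_carrier[OF H] subgroup.mem_carrier[OF K] by auto
  then have "c = (h' \<otimes> h) \<otimes> a \<otimes> (k \<otimes> k')"
    using hk(3) hk'(3) a by (simp add: m_assoc)
  then show "c \<in> double_coset G H a K"
    unfolding mem_double_coset_iff
    using subgroup.m_closed[OF H hk'(1) hk(1)] subgroup.m_closed[OF K hk(2) hk'(2)] by blast
qed

lemma double_coset_sym:
  assumes H: "subgroup H G" and K: "subgroup K G" and a: "a \<in> carrier G"
    and b: "b \<in> double_coset G H a K"
  shows "a \<in> double_coset G H b K"
proof -
  obtain h k where hk: "h \<in> H" "k \<in> K" "b = h \<otimes> a \<otimes> k"
    using b by (auto simp: mem_double_coset_iff)
  have "h \<in> carrier G" "k \<in> carrier G"
    using hk subgroup.mem_carrier[OF H] subgroup.mem_carrier[OF K] by auto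
  then have "a = inv h \<otimes> b \<otimes> inv k"
    using hk(3) a by (simp add: m_assoc inv_cancel_left)
  then show ?thesis
    unfolding mem_double_coset_iff
    using subgroup.m_inv_closed[OF H hk(1)] subgroup.m_inv_closed[OF K hk(2)] by blast
qed

lemma double_coset_eq_iff:
  assumes "subgroup H G" "subgroup K G" "a \<in> carrier G" "b \<in> carrier G"
  shows "double_coset G H a K = double_coset G H b K \<longleftrightarrow> b \<in> double_coset G H a K"
  using double_coset_self[of H K b] double_coset_sym[of H K a b]
    double_coset_subset[of H K a b] double_coset_subset[of H K b a] assms
  by blast

end


section \<open>Braid automorphisms as projected stabilizers\<close>

context group
begin

text \<open>By definition a braid automorphism agrees on \<open>V\<close> with a braid. Inverting that braid, which
  commutes with automorphisms, turns the condition into a fixed point equation for the action of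
  the product. This form is closed under products and inverses, and it is the one in which a braid
  automorphism enters the orbit of a pair.\<close>

lemma mem_BAut_iff:
  assumes V: "V \<in> spherical_systems G r"
  shows "\<phi> \<in> BAut G r V \<longleftrightarrow> \<phi> \<in> carrier (AutoGroup G) \<and>
    (\<exists>\<sigma>\<in>carrier (braid_group r). type_action G r (\<phi>, \<sigma>) V = V)"
proof -
  interpret B: group_action "braid_group r" "spherical_systems G r" "braid_action G r"
    by (rule braid_action_group_action)
  interpret BG: group "braid_group r" by (rule group_braid_group)
  have "(\<exists>\<sigma>\<in>carrier (braid_group r). aut_action G r \<phi> V = braid_action G r \<sigma> V) \<longleftrightarrow>
    (\<exists>\<sigma>\<in>carrier (braid_group r). type_action G r (\<phi>, \<sigma>) V = V)"
    if \<phi>: "\<phi> \<in> carrier (AutoGroup G)"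
  proof -
    note \<phi>V = aut_action_spherical[OF \<phi> V]
    have commute: "type_action G r (\<phi>, \<sigma>) V = braid_action G r \<sigma> (aut_action G r \<phi> V)"
      if "\<sigma> \<in> carrier (braid_group r)" for \<sigma>
      using aut_braid_commute[OF \<phi> that V] V by (simp add: type_action_def)
    show ?thesis
    proof
      assume "\<exists>\<sigma>\<in>carrier (braid_group r). aut_action G r \<phi> V = braid_action G r \<sigma> V"
      then obtain \<sigma> where \<sigma>: "\<sigma> \<in> carrier (braid_group r)"
        "braid_action G r \<sigma> V = aut_action G r \<phi> V"
        by auto
      have "type_action G r (\<phi>, inv\<^bsub>braid_group r\<^esub> \<sigma>) V = V"
        using commute[OF BG.inv_closed[OF \<sigma>(1)]] B.orbit_sym_aux[OF \<sigma>(1) V \<sigma>(2)] by simp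
      then show "\<exists>\<sigma>\<in>carrier (braid_group r). type_action G r (\<phi>, \<sigma>) V = V"
        using BG.inv_closed[OF \<sigma>(1)] by blast
    next
      assume "\<exists>\<sigma>\<in>carrier (braid_group r). type_action G r (\<phi>, \<sigma>) V = V"
      then obtain \<sigma> where \<sigma>: "\<sigma> \<in> carrier (braid_group r)"
        "braid_action G r \<sigma> (aut_action G r \<phi> V) = V"
        using commute by auto
      then have "aut_action G r \<phi> V = braid_action G r (inv\<^bsub>braid_group r\<^esub> \<sigma>) V"
        using B.orbit_sym_aux[OF \<sigma>(1) \<phi>V \<sigma>(2)] by simp
      then show "\<exists>\<sigma>\<in>carrier (braid_group r). aut_action G r \<phi> V = braid_action G r \<sigma> V"
        using BG.inv_closed[OF \<sigma>(1)] by blast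
    qed
  qed
  then show ?thesis by (auto simp: BAut_def)
qed

lemma BAut_eq_fst_stabilizer:
  assumes "V \<in> spherical_systems G r"
  shows "BAut G r V = fst ` stabilizer (AutoGroup G \<times>\<times> braid_group r) (type_action G r) V"
  by (force simp: mem_BAut_iff[OF assms] stabilizer_def)

lemma BAut_subgroup:
  assumes V: "V \<in> spherical_systems G r"
  shows "subgroup (BAut G r V) (AutoGroup G)"
proof -
  interpret T: group_action "AutoGroup G \<times>\<times> braid_group r" "spherical_systems G r"
      "type_action G r"
    by (rule type_action_group_action)
  have "fst \<in> hom (AutoGroup G \<times>\<times> braid_group r) (AutoGroup G)"
    by (auto simp: hom_def)
  then have "group_hom (AutoGroup G \<times>\<times> braid_group r) (AutoGroup G) fst"
    by (simp add: group_hom_def group_hom_axioms_def AutoGroup DirProd_group group_braid_group)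
  then show ?thesis
    unfolding BAut_eq_fst_stabilizer[OF V]
    by (rule group_hom.subgroup_img_is_subgroup[OF _ T.stabilizer_subgroup[OF V]])
qed


section \<open>Families as orbits of translates\<close>

lemma aut_action_eq_type_action:
  assumes V: "V \<in> spherical_systems G r"
  shows "aut_action G r \<phi> V = type_action G r (\<phi>, \<one>\<^bsub>braid_group r\<^esub>) V"
proof -
  interpret B: group_action "braid_group r" "spherical_systems G r" "braid_action G r"
    by (rule braid_action_group_action)
  show ?thesis
    using V fun_cong[OF B.id_eq_one, of V] by (simp add: type_action_def)
qed

lemma type_action_mult:
  assumes "V \<in> spherical_systems G r"
    and "\<phi> \<in> carrier (AutoGroup G)" "\<psi> \<in> carrier (AutoGroup G)"
    and "\<sigma> \<in> carrier (braid_group r)" "\<tau> \<in> carrier (braid_group r)"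
  shows "type_action G r (\<phi>, \<sigma>) (type_action G r (\<psi>, \<tau>) V) =
    type_action G r (\<phi> \<otimes>\<^bsub>AutoGroup G\<^esub> \<psi>, \<sigma> \<otimes>\<^bsub>braid_group r\<^esub> \<tau>) V"
proof -
  interpret T: group_action "AutoGroup G \<times>\<times> braid_group r" "spherical_systems G r"
      "type_action G r"
    by (rule type_action_group_action)
  show ?thesis
    using T.composition_rule[OF assms(1), of "(\<phi>, \<sigma>)" "(\<psi>, \<tau>)"] assms by simp
qed

lemma mem_pq_family_iff:
  assumes "V \<in> spherical_systems G r" "W \<in> spherical_systems G s"
  shows "(V', W') \<in> pq_family G r s (V, W) \<longleftrightarrow>
    (\<exists>\<phi>\<in>carrier (AutoGroup G). \<exists>\<sigma>\<in>carrier (braid_group r). \<exists>\<tau>\<in>carrier (braid_group s).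
      V' = type_action G r (\<phi>, \<sigma>) V \<and> W' = type_action G s (\<phi>, \<tau>) W)"
  using assms by (auto simp: pq_family_def orbit_def pair_action_def type_action_def)

lemma pq_family_eq_iff:
  assumes VW: "VW \<in> spherical_systems G r \<times> spherical_systems G s"
    and VW': "VW' \<in> spherical_systems G r \<times> spherical_systems G s"
  shows "pq_family G r s VW = pq_family G r s VW' \<longleftrightarrow> VW' \<in> pq_family G r s VW"
proof -
  interpret P: group_action "AutoGroup G \<times>\<times> braid_group r \<times>\<times> braid_group s"
      "spherical_systems G r \<times> spherical_systems G s" "pair_action G r s"
    by (rule pair_action_group_action)
  show ?thesis
    using P.disjoint_union[of "pq_family G r s VW" "pq_family G r s VW'"]
      P.orbit_refl[OF VW] P.orbit_refl[OF VW'] VW VW'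
    unfolding pq_family_def orbits_def by blast
qed

lemma type_action_spherical:
  assumes "V \<in> spherical_systems G r" "\<phi> \<in> carrier (AutoGroup G)" "\<sigma> \<in> carrier (braid_group r)"
  shows "type_action G r (\<phi>, \<sigma>) V \<in> spherical_systems G r"
  using group_action.element_image[OF type_action_group_action _ assms(1) refl, of "(\<phi>, \<sigma>)"] assms
  by simp

text \<open>If \<open>V' = \<alpha> \<sigma> V\<close> and \<open>W' = \<beta> \<tau> W\<close>, then applying \<open>(\<alpha>, \<sigma>, \<tau>)\<close> to \<open>(V, \<alpha>\<^sup>-\<^sup>1 \<beta> W)\<close> gives
  \<open>(V', W')\<close>. This normal form of a pair is what makes a single automorphism enough to label a
  family.\<close>

lemma pq_family_representative:
  assumes V: "V \<in> spherical_systems G r" and W: "W \<in> spherical_systems G s"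
    and V': "V' \<in> topological_type G r V" and W': "W' \<in> topological_type G s W"
  shows "\<exists>\<phi>\<in>carrier (AutoGroup G).
    pq_family G r s (V', W') = pq_family G r s (V, aut_action G s \<phi> W)"
proof -
  interpret A: group "AutoGroup G" by (rule AutoGroup)
  interpret S: group "braid_group s" by (rule group_braid_group)
  obtain \<alpha> \<sigma> where \<alpha>: "\<alpha> \<in> carrier (AutoGroup G)" "\<sigma> \<in> carrier (braid_group r)"
    "V' = type_action G r (\<alpha>, \<sigma>) V"
    using V' by (auto simp: topological_type_def orbit_def)
  obtain \<beta> \<tau> where \<beta>: "\<beta> \<in> carrier (AutoGroup G)" "\<tau> \<in> carrier (braid_group s)"
    "W' = type_action G s (\<beta>, \<tau>) W"
    using W' by (auto simp: topological_type_def orbit_def)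
  define \<phi> where "\<phi> = inv\<^bsub>AutoGroup G\<^esub> \<alpha> \<otimes>\<^bsub>AutoGroup G\<^esub> \<beta>"
  have \<phi>: "\<phi> \<in> carrier (AutoGroup G)" "\<alpha> \<otimes>\<^bsub>AutoGroup G\<^esub> \<phi> = \<beta>"
    using \<alpha>(1) \<beta>(1) by (simp_all add: \<phi>_def A.inv_cancel_left)
  have "W' = type_action G s (\<alpha>, \<tau>) (aut_action G s \<phi> W)"
    using \<alpha>(1) \<beta> \<phi> W by (simp add: aut_action_eq_type_action type_action_mult)
  then have "(V', W') \<in> pq_family G r s (V, aut_action G s \<phi> W)"
    using \<alpha> \<beta>(2) by (auto simp: mem_pq_family_iff[OF V aut_action_spherical[OF \<phi>(1) W]])
  moreover have "V' \<in> spherical_systems G r" "W' \<in> spherical_systems G s"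
    using \<alpha> \<beta> V W by (simp_all add: type_action_spherical)
  ultimately have "pq_family G r s (V, aut_action G s \<phi> W) = pq_family G r s (V', W')"
    using V aut_action_spherical[OF \<phi>(1) W] by (simp add: pq_family_eq_iff)
  then show ?thesis using \<phi>(1) by metis
qed

text \<open>The automorphism \<open>\<alpha>\<close> in an element of the acting group that identifies the two pairs is the
  only link between the components: fixing \<open>V\<close> puts \<open>\<alpha>\<close> in the left subgroup, and the second
  component then determines \<open>\<psi>\<close> from \<open>\<alpha> \<phi>\<close> up to the right subgroup.\<close>

lemma pq_family_translate_eq_iff:
  assumes V: "V \<in> spherical_systems G r" and W: "W \<in> spherical_systems G s"
    and \<phi>: "\<phi> \<in> carrier (AutoGroup G)" and \<psi>: "\<psi> \<in> carrier (AutoGroup G)"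
  shows "pq_family G r s (V, aut_action G s \<phi> W) = pq_family G r s (V, aut_action G s \<psi> W) \<longleftrightarrow>
    \<psi> \<in> double_coset (AutoGroup G) (BAut G r V) \<phi> (BAut G s W)"
    (is "?L = ?R \<longleftrightarrow> _")
proof -
  interpret A: group "AutoGroup G" by (rule AutoGroup)
  interpret S: group "braid_group s" by (rule group_braid_group)
  interpret T: group_action "AutoGroup G \<times>\<times> braid_group s" "spherical_systems G s"
      "type_action G s"
    by (rule type_action_group_action)
  note \<phi>W = aut_action_spherical[OF \<phi> W] and \<psi>W = aut_action_spherical[OF \<psi> W]
  have "?L = ?R \<longleftrightarrow> (V, aut_action G s \<psi> W) \<in> ?L"
    using V \<phi>W \<psi>W by (simp add: pq_family_eq_iff)
  also have "\<dots> \<longleftrightarrow> \<psi> \<in> double_coset (AutoGroup G) (BAut G r V) \<phi> (BAut G s W)"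
  proof
    assume "(V, aut_action G s \<psi> W) \<in> ?L"
    then obtain \<alpha> \<sigma> \<tau> where \<alpha>: "\<alpha> \<in> carrier (AutoGroup G)" and \<sigma>: "\<sigma> \<in> carrier (braid_group r)"
      and \<tau>: "\<tau> \<in> carrier (braid_group s)" and V_fixed: "type_action G r (\<alpha>, \<sigma>) V = V"
      and moved: "aut_action G s \<psi> W = type_action G s (\<alpha>, \<tau>) (aut_action G s \<phi> W)"
      by (auto simp: mem_pq_family_iff[OF V \<phi>W])
    define \<beta> where "\<beta> = inv\<^bsub>AutoGroup G\<^esub> \<psi> \<otimes>\<^bsub>AutoGroup G\<^esub> (\<alpha> \<otimes>\<^bsub>AutoGroup G\<^esub> \<phi>)"
    have \<beta>: "\<beta> \<in> carrier (AutoGroup G)" using \<alpha> \<phi> \<psi> by (simp add: \<beta>_def)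
    have "type_action G s (\<beta>, \<tau>) W =
        aut_action G s (inv\<^bsub>AutoGroup G\<^esub> \<psi>) (type_action G s (\<alpha>, \<tau>) (aut_action G s \<phi> W))"
      using \<alpha> \<tau> \<phi> \<psi> W
      by (simp add: aut_action_eq_type_action type_action_mult type_action_spherical \<beta>_def)
    also have "\<dots> = aut_action G s (inv\<^bsub>AutoGroup G\<^esub> \<psi>) (aut_action G s \<psi> W)"
      by (simp only: moved)
    also have "\<dots> = W"
      using group_action.orbit_sym_aux[OF aut_action_group_action \<psi> W refl] .
    finally have "\<beta> \<in> BAut G s W" using \<beta> \<tau> by (auto simp: mem_BAut_iff[OF W])
    then have "inv\<^bsub>AutoGroup G\<^esub> \<beta> \<in> BAut G s W"
      by (rule subgroup.m_inv_closed[OF BAut_subgroup[OF W]])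
    moreover have "\<alpha> \<in> BAut G r V" using \<alpha> \<sigma> V_fixed by (auto simp: mem_BAut_iff[OF V])
    moreover have "\<psi> = \<alpha> \<otimes>\<^bsub>AutoGroup G\<^esub> \<phi> \<otimes>\<^bsub>AutoGroup G\<^esub> inv\<^bsub>AutoGroup G\<^esub> \<beta>"
    proof (subst A.inv_solve_right)
      show "\<alpha> \<otimes>\<^bsub>AutoGroup G\<^esub> \<phi> = \<psi> \<otimes>\<^bsub>AutoGroup G\<^esub> \<beta>"
        using \<alpha> \<phi> \<psi> by (simp add: \<beta>_def A.inv_cancel_left)
    qed (use \<alpha> \<phi> \<psi> \<beta> in simp_all)
    ultimately show "\<psi> \<in> double_coset (AutoGroup G) (BAut G r V) \<phi> (BAut G s W)"
      unfolding A.mem_double_coset_iff by blast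
  next
    assume "\<psi> \<in> double_coset (AutoGroup G) (BAut G r V) \<phi> (BAut G s W)"
    then obtain \<alpha> \<beta> where \<alpha>_BAut: "\<alpha> \<in> BAut G r V" and \<beta>_BAut: "\<beta> \<in> BAut G s W"
      and \<psi>_eq: "\<psi> = \<alpha> \<otimes>\<^bsub>AutoGroup G\<^esub> \<phi> \<otimes>\<^bsub>AutoGroup G\<^esub> \<beta>"
      unfolding A.mem_double_coset_iff by blast
    obtain \<sigma> where \<alpha>: "\<alpha> \<in> carrier (AutoGroup G)" and \<sigma>: "\<sigma> \<in> carrier (braid_group r)"
      and V_fixed: "type_action G r (\<alpha>, \<sigma>) V = V"
      using \<alpha>_BAut by (auto simp: mem_BAut_iff[OF V])
    obtain \<tau> where \<beta>: "\<beta> \<in> carrier (AutoGroup G)" and \<tau>: "\<tau> \<in> carrier (braid_group s)"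
      and W_fixed: "type_action G s (\<beta>, \<tau>) W = W"
      using \<beta>_BAut by (auto simp: mem_BAut_iff[OF W])
    let ?\<beta>' = "inv\<^bsub>AutoGroup G\<^esub> \<beta>" and ?\<tau>' = "inv\<^bsub>braid_group s\<^esub> \<tau>"
    have W_fixed': "type_action G s (?\<beta>', ?\<tau>') W = W"
      using T.orbit_sym_aux[OF _ W W_fixed] \<beta> \<tau> by (simp add: AutoGroup group_braid_group)
    \<comment> \<open>On \<open>W\<close>, the factor \<open>\<beta>\<close> of \<open>\<psi>\<close> acts as a braid, and that braid can be moved past
      \<open>\<alpha> \<phi>\<close>.\<close>
    have "aut_action G s \<psi> W = aut_action G s \<psi> (type_action G s (?\<beta>', ?\<tau>') W)"
      by (simp only: W_fixed')
    also have "\<dots> = type_action G s (\<alpha>, ?\<tau>') (aut_action G s \<phi> W)"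
      using \<alpha> \<beta> \<phi> \<psi> \<tau> W
      by (simp add: aut_action_eq_type_action type_action_mult type_action_spherical
          \<psi>_eq A.m_assoc)
    finally show "(V, aut_action G s \<psi> W) \<in> ?L"
      unfolding mem_pq_family_iff[OF V \<phi>W]
      using \<alpha> \<sigma> V_fixed S.inv_closed[OF \<tau>] by (metis (no_types))
  qed
  finally show ?thesis .
qed

lemma families_of_types_eq_translates:
  assumes V: "V \<in> spherical_systems G r" and W: "W \<in> spherical_systems G s"
  shows "families_of_types G r s (topological_type G r V) (topological_type G s W) =
    (\<lambda>\<phi>. pq_family G r s (V, aut_action G s \<phi> W)) ` carrier (AutoGroup G)"
proof
  show "families_of_types G r s (topological_type G r V) (topological_type G s W) \<subseteq>
    (\<lambda>\<phi>. pq_family G r s (V, aut_action G s \<phi> W)) ` carrier (AutoGroup G)"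
    using pq_family_representative[OF V W] by (fastforce simp: families_of_types_def)
  have "V \<in> topological_type G r V"
    unfolding topological_type_def
    by (rule group_action.orbit_refl[OF type_action_group_action V])
  moreover have "aut_action G s \<phi> W \<in> topological_type G s W"
    if "\<phi> \<in> carrier (AutoGroup G)" for \<phi>
    using that group.is_monoid[OF group_braid_group[of s], THEN monoid.one_closed]
    by (force simp: aut_action_eq_type_action[OF W] topological_type_def orbit_def)
  ultimately show "(\<lambda>\<phi>. pq_family G r s (V, aut_action G s \<phi> W)) ` carrier (AutoGroup G) \<subseteq>
    families_of_types G r s (topological_type G r V) (topological_type G s W)"
    by (auto simp: families_of_types_def)
qed

end


section \<open>The bijection\<close>

lemma bij_betw_images_of_same_kernel:
  assumes "\<And>x y. x \<in> A \<Longrightarrow> y \<in> A \<Longrightarrow> p x = p y \<longleftrightarrow> q x = q y"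
  shows "\<exists>f. bij_betw f (p ` A) (q ` A) \<and> (\<forall>x\<in>A. f (p x) = q x)"
proof (intro exI conjI)
  let ?f = "\<lambda>c. q (inv_into A p c)"
  show f: "\<forall>x\<in>A. ?f (p x) = q x"
    using assms by (metis f_inv_into_f imageI inv_into_into)
  then show "bij_betw ?f (p ` A) (q ` A)"
    using assms by (auto simp: bij_betw_def inj_on_def image_image)
qed

theorem theorem0p1:
  fixes G :: "('a, 'b) monoid_scheme"
    and r s :: nat
    and V1 V2 :: "'a list"
  assumes "group G" and "finite (carrier G)"
    and "V1 \<in> spherical_systems G r" and "V2 \<in> spherical_systems G s"
    and "topological_type G r V1 \<noteq> topological_type G s V2"
  shows "\<exists>f. bij_betw f
      (double_cosets (AutoGroup G) (BAut G r V1) (BAut G s V2))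
      (families_of_types G r s (topological_type G r V1) (topological_type G s V2)) \<and>
    (\<forall>\<phi>\<in>carrier (AutoGroup G).
      f (double_coset (AutoGroup G) (BAut G r V1) \<phi> (BAut G s V2)) =
        pq_family G r s (V1, aut_action G s \<phi> V2))"
proof -
  interpret group G by (rule assms(1))
  show ?thesis
    unfolding families_of_types_eq_translates[OF assms(3,4)] double_cosets_def
  proof (rule bij_betw_images_of_same_kernel)
    fix \<phi> \<psi> assume "\<phi> \<in> carrier (AutoGroup G)" "\<psi> \<in> carrier (AutoGroup G)"
    then show "double_coset (AutoGroup G) (BAut G r V1) \<phi> (BAut G s V2) =
        double_coset (AutoGroup G) (BAut G r V1) \<psi> (BAut G s V2) \<longleftrightarrow>
      pq_family G r s (V1, aut_action G s \<phi> V2) = pq_family G r s (V1, aut_action G s \<psi> V2)"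
      using group.double_coset_eq_iff[OF AutoGroup BAut_subgroup BAut_subgroup]
        pq_family_translate_eq_iff assms(3,4) by simp
  qed
qed

end
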